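(* Let $G$ be a weakly branched (self-similar) group with a branching subgroup $K$ that contains a non-trivial element of finite order. Then $K$ contains a subgroup isomorphic to $K\wr(\mathbb{Z}/p)$ for some $p\ge2$.
   Context: Let $X$ be a finite set and $W$ the automorphism group of the regular rooted tree $X^*$ (edges between $v$ and $vx$), acting on the right. For $g\in W$ let $\pi\in\mathrm{Sym}(X)$ be the restriction of $g$ to $X$, and for $x\in X$ let $g@x\in W$ be defined by $(xv)^g=x^{\pi}v^{g@x}$. The map $\phi:W\to W^X\rtimes\mathrm{Sym}(X)$, $g\mapsto(x\mapsto g@x)\,\pi$, is an isomorphism. A subgroup $G\le W$ is self-similar if $g@x\in G$ for all $g\in G$, $x\in X$. A self-similar group $G$ is weakly branched if there is a non-trivial subgroup $K\le G$ with $\phi(K)\ge K^X$, i.e. for all $k\in K$, $x\in X$ the automorphism acting as $k$ on $xX^*$ (that is $xv\mapsto xv^k$) and trivially elsewhere lies in $K$; such a $K$ is called a branching subgroup. No transitivity on levels is required. $K\wr(\mathbb{Z}/p)$ is the regular wreath product $K^{\mathbb{Z}/p}\rtimes\mathbb{Z}/p$, with $\mathbb{Z}/p$ acting by shifts. *)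

theory Defs
  imports "HOL-Algebra.Algebra"
begin

section \<open>Automorphisms of the regular rooted tree\<close>

definition tree_adj :: "'x list \<Rightarrow> 'x list \<Rightarrow> bool" where
  "tree_adj u v \<longleftrightarrow> (\<exists>x. v = u @ [x] \<or> u = v @ [x])"

definition is_tree_aut :: "('x list \<Rightarrow> 'x list) \<Rightarrow> bool" where
  "is_tree_aut g \<longleftrightarrow> bij g \<and> g [] = [] \<and> (\<forall>u v. tree_adj (g u) (g v) \<longleftrightarrow> tree_adj u v)"

text \<open>Automorphisms act on the right, so the product of \<open>g\<close> and \<open>h\<close> applies \<open>g\<close> first.\<close>

definition tree_aut_group :: "('x list \<Rightarrow> 'x list) monoid" where
  "tree_aut_group = \<lparr>carrier = {g. is_tree_aut g}, monoid.mult = (\<lambda>g h. h \<circ> g), one = id\<rparr>"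

text \<open>
  The permutation of \<open>X\<close> induced by \<open>g\<close>, and the state \<open>g@x\<close>. For tree automorphisms, the
  recursion \<open>(xv)\<^sup>g = x\<^sup>\<pi> v\<^sup>g\<^sup>@\<^sup>x\<close> is lemma \<open>tree_aut_Cons\<close>, and
  \<open>g@x\<close> is again a tree automorphism by lemma \<open>is_tree_aut_state\<close>.
\<close>

definition root_perm :: "('x list \<Rightarrow> 'x list) \<Rightarrow> 'x \<Rightarrow> 'x" where
  "root_perm g x = hd (g [x])"

definition state :: "('x list \<Rightarrow> 'x list) \<Rightarrow> 'x \<Rightarrow> 'x list \<Rightarrow> 'x list" where
  "state g x v = tl (g (x # v))"

definition wreath_rec :: "('x list \<Rightarrow> 'x list) \<Rightarrow> ('x \<Rightarrow> 'x list \<Rightarrow> 'x list) \<times> ('x \<Rightarrow> 'x)" where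
  "wreath_rec g = (state g, root_perm g)"

definition self_similar :: "('x::finite list \<Rightarrow> 'x list) set \<Rightarrow> bool" where
  "self_similar G \<longleftrightarrow> subgroup G tree_aut_group \<and> (\<forall>g\<in>G. \<forall>x. state g x \<in> G)"

text \<open>
  The last condition says that the image of \<open>K\<close> under the wreath recursion contains \<open>K\<^sup>X\<close>;
  see lemma \<open>base_subset_iff\<close> for its elementwise form.
\<close>

definition branching_subgroup ::
  "('x::finite list \<Rightarrow> 'x list) set \<Rightarrow> ('x list \<Rightarrow> 'x list) set \<Rightarrow> bool" where
  "branching_subgroup K G \<longleftrightarrow>
     subgroup K (tree_aut_group\<lparr>carrier := G\<rparr>) \<and> K \<noteq> {\<one>\<^bsub>tree_aut_group\<^esub>} \<and>
     (UNIV \<rightarrow> K) \<times> {id} \<subseteq> wreath_rec ` K"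

definition weakly_branched :: "('x::finite list \<Rightarrow> 'x list) set \<Rightarrow> bool" where
  "weakly_branched G \<longleftrightarrow> self_similar G \<and> (\<exists>K. branching_subgroup K G)"


section \<open>Regular wreath products\<close>

definition semidirect_product ::
  "('n, 'a) monoid_scheme \<Rightarrow> ('h, 'b) monoid_scheme \<Rightarrow> ('h \<Rightarrow> 'n \<Rightarrow> 'n) \<Rightarrow> ('n \<times> 'h) monoid" where
  "semidirect_product N H \<alpha> =
     \<lparr>carrier = carrier N \<times> carrier H,
      monoid.mult = (\<lambda>(n, h) (n', h'). (n \<otimes>\<^bsub>N\<^esub> \<alpha> h n', h \<otimes>\<^bsub>H\<^esub> h')),
      one = (\<one>\<^bsub>N\<^esub>, \<one>\<^bsub>H\<^esub>)\<rparr>"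

text \<open>The shift by \<open>b\<close> is \<open>f \<mapsto> (i \<mapsto> f (i b))\<close>, a left action of \<open>B\<close> on \<open>A\<^sup>B\<close>.\<close>

definition regular_wreath ::
  "('a, 'm) monoid_scheme \<Rightarrow> ('b, 'n) monoid_scheme \<Rightarrow> (('b \<Rightarrow> 'a) \<times> 'b) monoid" where
  "regular_wreath A B =
     semidirect_product (product_group (carrier B) (\<lambda>_. A)) B
       (\<lambda>b f. \<lambda>i\<in>carrier B. f (i \<otimes>\<^bsub>B\<^esub> b))"


section \<open>Basic facts\<close>

lemma is_tree_aut_id: "is_tree_aut id"
  by (simp add: is_tree_aut_def)

lemma is_tree_aut_comp: "is_tree_aut g \<Longrightarrow> is_tree_aut h \<Longrightarrow> is_tree_aut (h \<circ> g)"
  by (simp add: is_tree_aut_def bij_comp)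

lemma is_tree_aut_inv:
  assumes "is_tree_aut g" shows "is_tree_aut (inv_into UNIV g)"
proof -
  have b: "bij g" using assms by (simp add: is_tree_aut_def)
  have 1: "inv_into UNIV g [] = []"
    using assms b by (metis bij_inv_eq_iff is_tree_aut_def)
  have "tree_adj (inv_into UNIV g u) (inv_into UNIV g v) \<longleftrightarrow> tree_adj u v" for u v
    using assms b unfolding is_tree_aut_def by (metis bij_inv_eq_iff)
  with b 1 show ?thesis by (simp add: is_tree_aut_def bij_imp_bij_inv)
qed

lemma group_tree_aut_group: "group (tree_aut_group :: ('x list \<Rightarrow> 'x list) monoid)"
proof (rule groupI)
  fix g :: "'x list \<Rightarrow> 'x list"
  assume "g \<in> carrier tree_aut_group"
  then have g: "is_tree_aut g" by (simp add: tree_aut_group_def)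
  then have "g \<circ> inv_into UNIV g = id" by (simp add: is_tree_aut_def bij_is_surj fun_eq_iff surj_f_inv_f)
  with is_tree_aut_inv[OF g]
  show "\<exists>h\<in>carrier tree_aut_group. h \<otimes>\<^bsub>tree_aut_group\<^esub> g = \<one>\<^bsub>tree_aut_group\<^esub>"
    by (auto simp: tree_aut_group_def)
qed (auto simp: tree_aut_group_def is_tree_aut_id is_tree_aut_comp comp_assoc)

lemma tree_aut_snoc:
  assumes "is_tree_aut g" shows "\<exists>y. g (u @ [x]) = g u @ [y]"
proof (induction u arbitrary: x rule: rev_induct)
  case Nil
  have "g [] = []" using assms by (simp add: is_tree_aut_def)
  moreover have "tree_adj [] [x]" by (simp add: tree_adj_def)
  then have "tree_adj (g []) (g [x])" using assms unfolding is_tree_aut_def by blast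
  ultimately show ?case by (simp add: tree_adj_def)
next
  case (snoc z u)
  from snoc.IH obtain c where c: "g (u @ [z]) = g u @ [c]" by blast
  have "tree_adj (g (u @ [z])) (g ((u @ [z]) @ [x]))"
    using assms by (simp add: is_tree_aut_def tree_adj_def)
  moreover have "g (u @ [z]) \<noteq> g ((u @ [z]) @ [x]) @ [y]" for y
  proof
    assume "g (u @ [z]) = g ((u @ [z]) @ [x]) @ [y]"
    with c have "g u = g ((u @ [z]) @ [x])" by simp
    moreover have "inj g" using assms by (simp add: is_tree_aut_def bij_is_inj)
    ultimately have "u = (u @ [z]) @ [x]" by (rule injD[rotated])
    then show False by simp
  qed
  ultimately show ?case unfolding tree_adj_def by blast
qed

lemma tree_aut_Cons:
  assumes "is_tree_aut g" shows "g (x # v) = root_perm g x # state g x v"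
proof -
  have "g (x # v) \<noteq> [] \<and> hd (g (x # v)) = hd (g [x])"
  proof (induction v rule: rev_induct)
    case Nil
    from tree_aut_snoc[OF assms, of "[]" x] show ?case by auto
  next
    case (snoc y v)
    with tree_aut_snoc[OF assms, of "x # v" y] show ?case by auto
  qed
  then show ?thesis unfolding root_perm_def state_def by (metis list.collapse)
qed

lemma tree_adj_Cons: "tree_adj (x # u) (x # v) \<longleftrightarrow> tree_adj u v"
  by (simp add: tree_adj_def)

lemma state_Nil: "is_tree_aut g \<Longrightarrow> state g x [] = []"
  using tree_aut_snoc[of g "[]" x] by (auto simp: state_def is_tree_aut_def)

lemma is_tree_aut_state:
  assumes g: "is_tree_aut g" shows "is_tree_aut (state g x)"
proof -
  let ?h = "inv_into UNIV g"
  have h: "is_tree_aut ?h" using is_tree_aut_inv[OF g] .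
  have b: "bij g" using g by (simp add: is_tree_aut_def)
  have "inj (state g x)"
  proof (rule injI)
    fix u v assume "state g x u = state g x v"
    then have "g (x # u) = g (x # v)" using g by (simp add: tree_aut_Cons)
    then show "u = v" using b by (metis bij_is_inj injD list.inject)
  qed
  moreover have "\<exists>u. w = state g x u" for w
  proof -
    have "?h [root_perm g x] = [x]"
      using tree_aut_Cons[OF g, of x "[]"] state_Nil[OF g, of x] b by (metis bij_inv_eq_iff)
    then have "?h (root_perm g x # w) = x # state ?h (root_perm g x) w"
      using tree_aut_Cons[OF h, of "root_perm g x"] by (simp add: root_perm_def)
    then have "root_perm g x # w = g (x # state ?h (root_perm g x) w)"
      using b by (metis bij_inv_eq_iff)
    then show ?thesis using g by (auto simp: tree_aut_Cons)
  qed
  moreover have "tree_adj (state g x u) (state g x v) \<longleftrightarrow> tree_adj u v" for u v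
    using g tree_adj_Cons tree_aut_Cons[OF g] unfolding is_tree_aut_def by metis
  ultimately show ?thesis
    using state_Nil[OF g] by (auto simp: is_tree_aut_def bij_def surj_def)
qed

lemma tree_aut_eqI:
  assumes "is_tree_aut g" "is_tree_aut h" "wreath_rec g = wreath_rec h" shows "g = h"
proof
  fix w show "g w = h w"
    using assms by (cases w) (auto simp: wreath_rec_def tree_aut_Cons, auto simp: is_tree_aut_def)
qed

text \<open>The automorphism acting as \<open>k\<close> below \<open>x\<close> and trivially elsewhere.\<close>

definition act_below :: "'x \<Rightarrow> ('x list \<Rightarrow> 'x list) \<Rightarrow> 'x list \<Rightarrow> 'x list" where
  "act_below x k w = (case w of [] \<Rightarrow> [] | y # v \<Rightarrow> if y = x then y # k v else w)"

definition act_on_children :: "('x \<Rightarrow> 'x list \<Rightarrow> 'x list) \<Rightarrow> 'x list \<Rightarrow> 'x list" where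
  "act_on_children f w = (case w of [] \<Rightarrow> [] | y # v \<Rightarrow> y # f y v)"

lemma wreath_rec_eq_iff:
  assumes "is_tree_aut g"
  shows "wreath_rec g = (f, id) \<longleftrightarrow> g = act_on_children f"
proof
  assume "wreath_rec g = (f, id)"
  then show "g = act_on_children f"
    using assms
    by (auto simp: wreath_rec_def act_on_children_def fun_eq_iff tree_aut_Cons is_tree_aut_def
        split: list.split)
next
  assume "g = act_on_children f"
  then show "wreath_rec g = (f, id)"
    by (auto simp: wreath_rec_def act_on_children_def fun_eq_iff state_def root_perm_def)
qed

lemma base_subset_iff:
  fixes K :: "('x::finite list \<Rightarrow> 'x list) set"
  assumes "subgroup K tree_aut_group"
  shows "(UNIV \<rightarrow> K) \<times> {id} \<subseteq> wreath_rec ` K \<longleftrightarrow> (\<forall>k\<in>K. \<forall>x. act_below x k \<in> K)"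
proof -
  have aut: "is_tree_aut k" if "k \<in> K" for k
    using subgroup.subset[OF assms] that by (auto simp: tree_aut_group_def)
  have idK: "id \<in> K" using subgroup.one_closed[OF assms] by (simp add: tree_aut_group_def)
  have compK: "h \<circ> g \<in> K" if "g \<in> K" "h \<in> K" for g h
    using subgroup.m_closed[OF assms that] by (simp add: tree_aut_group_def)
  have image_iff: "(f, id) \<in> wreath_rec ` K \<longleftrightarrow> act_on_children f \<in> K" for f
    using aut wreath_rec_eq_iff by (metis (no_types, lifting) image_iff)
  have "(\<forall>f. (\<forall>x. f x \<in> K) \<longrightarrow> act_on_children f \<in> K) \<longleftrightarrow> (\<forall>k\<in>K. \<forall>x. act_below x k \<in> K)"
  proof (intro iffI ballI allI impI)
    fix k x assume *: "\<forall>f. (\<forall>x. f x \<in> K) \<longrightarrow> act_on_children f \<in> K" and "k \<in> K"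
    have "act_below x k = act_on_children (\<lambda>y. if y = x then k else id)"
      by (auto simp: act_below_def act_on_children_def fun_eq_iff split: list.split)
    then show "act_below x k \<in> K" using * \<open>k \<in> K\<close> idK by simp
  next
    fix f :: "'x \<Rightarrow> 'x list \<Rightarrow> 'x list"
    assume *: "\<forall>k\<in>K. \<forall>x. act_below x k \<in> K" and f: "\<forall>x. f x \<in> K"
    have "act_on_children (\<lambda>y. if y \<in> S then f y else id) \<in> K" if "finite S" for S
      using that
    proof (induction S)
      case empty
      have "act_on_children (\<lambda>y. id) = (id :: 'x list \<Rightarrow> 'x list)"
        by (auto simp: act_on_children_def fun_eq_iff split: list.split)
      then show ?case unfolding empty_iff if_False using idK by metis
    next
      case (insert x S)
      have eq: "act_on_children (\<lambda>y. if y \<in> insert x S then f y else id) =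
          act_below x (f x) \<circ> act_on_children (\<lambda>y. if y \<in> S then f y else id)"
        using insert.hyps
        by (auto simp: act_below_def act_on_children_def fun_eq_iff split: list.split)
      have "act_below x (f x) \<in> K" using * f by blast
      then show ?case unfolding eq by (rule compK[OF insert.IH])
    qed
    from this[of UNIV] show "act_on_children f \<in> K" by simp
  qed
  moreover have "(UNIV \<rightarrow> K) \<times> {id} \<subseteq> wreath_rec ` K \<longleftrightarrow>
      (\<forall>f. (\<forall>x. f x \<in> K) \<longrightarrow> (f, id) \<in> wreath_rec ` K)"
    by (auto simp: Pi_iff)
  ultimately show ?thesis by (simp only: image_iff)
qed

lemma group_regular_wreath:
  assumes "group A" "group B" shows "group (regular_wreath A B)"
proof -
  interpret A: group A by fact
  interpret B: group B by fact
  note wreath_simps = regular_wreath_def semidirect_product_def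
  show ?thesis
  proof (rule groupI)
    fix y z assume "y \<in> carrier (regular_wreath A B)" "z \<in> carrier (regular_wreath A B)"
    then show "y \<otimes>\<^bsub>regular_wreath A B\<^esub> z \<in> carrier (regular_wreath A B)"
      by (cases y; cases z) (simp add: wreath_simps PiE_iff)
  next
    show "\<one>\<^bsub>regular_wreath A B\<^esub> \<in> carrier (regular_wreath A B)"
      by (simp add: wreath_simps PiE_iff)
  next
    fix x y z
    assume "x \<in> carrier (regular_wreath A B)" "y \<in> carrier (regular_wreath A B)"
      "z \<in> carrier (regular_wreath A B)"
    then show "x \<otimes>\<^bsub>regular_wreath A B\<^esub> y \<otimes>\<^bsub>regular_wreath A B\<^esub> z =
        x \<otimes>\<^bsub>regular_wreath A B\<^esub> (y \<otimes>\<^bsub>regular_wreath A B\<^esub> z)"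
      by (cases x; cases y; cases z)
        (simp add: wreath_simps PiE_iff A.m_assoc B.m_assoc cong: restrict_cong)
  next
    fix z assume "z \<in> carrier (regular_wreath A B)"
    then show "\<one>\<^bsub>regular_wreath A B\<^esub> \<otimes>\<^bsub>regular_wreath A B\<^esub> z = z"
      by (cases z) (simp add: wreath_simps PiE_iff extensional_restrict cong: restrict_cong)
  next
    fix z assume z: "z \<in> carrier (regular_wreath A B)"
    obtain f b where fb: "z = (f, b)" by (cases z)
    let ?z = "(\<lambda>i\<in>carrier B. inv\<^bsub>A\<^esub> f (i \<otimes>\<^bsub>B\<^esub> inv\<^bsub>B\<^esub> b), inv\<^bsub>B\<^esub> b)"
    have "?z \<in> carrier (regular_wreath A B)"
      using z fb by (simp add: wreath_simps PiE_iff)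
    moreover have "?z \<otimes>\<^bsub>regular_wreath A B\<^esub> z = \<one>\<^bsub>regular_wreath A B\<^esub>"
      using z fb by (simp add: wreath_simps PiE_iff cong: restrict_cong)
    ultimately show "\<exists>y\<in>carrier (regular_wreath A B).
        y \<otimes>\<^bsub>regular_wreath A B\<^esub> z = \<one>\<^bsub>regular_wreath A B\<^esub>" by blast
  qed
qed

end

theory Submission
  imports Defs
begin

text \<open>
  A suitable power \<open>t\<close> of the given torsion element has prime order \<open>p\<close>. A vertex \<open>v\<close> moved by \<open>t\<close>
  then has a \<open>\<langle>t\<rangle>\<close>-orbit of size exactly \<open>p\<close>, and the copy of \<open>K\<close> acting below \<open>v\<close> lies in \<open>K\<close>.
  Its \<open>p\<close> conjugates under powers of \<open>t\<close> act below distinct vertices of one level, so they generate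
  \<open>K\<^sup>p\<close>, on which \<open>t\<close> acts by cyclic shifts; no non-trivial power of \<open>t\<close> fixes \<open>v\<close>, so together
  they generate \<open>K \<wr> (\<int>/p)\<close>.
\<close>

section \<open>Spreading maps along a free orbit\<close>

text \<open>
  \<open>\<iota>\<close> parametrises a tile of \<open>'a\<close> whose \<open>p\<close> translates under \<open>t\<close> are disjoint, and \<open>D g\<close> is \<open>g\<close>
  transported to this tile and extended by the identity.
\<close>

locale cyclic_tiles =
  fixes t :: "'a \<Rightarrow> 'a" and p :: nat and \<iota> :: "'b \<Rightarrow> 'a" and D :: "('b \<Rightarrow> 'b) \<Rightarrow> 'a \<Rightarrow> 'a"
  assumes p_pos: "p > 0"
    and t_pow_p: "t ^^ p = id"
    and tiles_inj: "\<lbrakk>i < p; j < p; (t ^^ i) (\<iota> w) = (t ^^ j) (\<iota> w')\<rbrakk> \<Longrightarrow> i = j \<and> w = w'"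
    and D_tile: "D g (\<iota> w) = \<iota> (g w)"
    and D_off: "u \<notin> range \<iota> \<Longrightarrow> D g u = u"
begin

text \<open>As \<open>t\<close> has period \<open>p\<close>, the exponent \<open>p - m\<close>
  stands for \<open>-m\<close>: for \<open>m < p\<close> this is a conjugate of \<open>D g\<close>,
  supported on the \<open>m\<close>-th tile.\<close>

definition conj_D :: "nat \<Rightarrow> ('b \<Rightarrow> 'b) \<Rightarrow> 'a \<Rightarrow> 'a" where
  "conj_D m g = t ^^ m \<circ> D g \<circ> t ^^ (p - m)"

primrec spread :: "(int \<Rightarrow> 'b \<Rightarrow> 'b) \<Rightarrow> nat \<Rightarrow> 'a \<Rightarrow> 'a" where
  "spread f 0 = id"
| "spread f (Suc m) = conj_D m (f (int m)) \<circ> spread f m"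

text \<open>The base part acts before the power of \<open>t\<close>: in a right action the left
  factor of the pair comes first.\<close>

definition wreath_map :: "(int \<Rightarrow> 'b \<Rightarrow> 'b) \<times> int \<Rightarrow> 'a \<Rightarrow> 'a" where
  "wreath_map = (\<lambda>(f, b). t ^^ nat b \<circ> spread f p)"

definition tiles :: "'a set" where
  "tiles = (\<Union>i<p. range (\<lambda>w. (t ^^ i) (\<iota> w)))"

lemma funpow_mod: "t ^^ (n mod p) = t ^^ n"
proof
  show "(t ^^ (n mod p)) x = (t ^^ n) x" for x
    by (rule funpow_mod_eq) (simp add: t_pow_p)
qed

lemma tiles_iff: "u \<in> tiles \<longleftrightarrow> (\<exists>i w. u = (t ^^ i) (\<iota> w))"
proof
  assume "\<exists>i w. u = (t ^^ i) (\<iota> w)"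
  then obtain i w where "u = (t ^^ (i mod p)) (\<iota> w)" by (auto simp: funpow_mod)
  moreover have "i mod p < p" using p_pos by simp
  ultimately show "u \<in> tiles" unfolding tiles_def by blast
qed (auto simp: tiles_def)

lemma tile_mem: "(t ^^ i) (\<iota> w) \<in> tiles" "\<iota> w \<in> tiles"
proof -
  show *: "(t ^^ i) (\<iota> w) \<in> tiles" for i by (auto simp: tiles_iff)
  from *[of 0] show "\<iota> w \<in> tiles" by simp
qed

lemma funpow_add_apply: "(t ^^ m) ((t ^^ n) x) = (t ^^ (m + n)) x"
  by (simp add: funpow_add)

lemma funpow_tiles_iff: "(t ^^ n) u \<in> tiles \<longleftrightarrow> u \<in> tiles"
proof
  assume "(t ^^ n) u \<in> tiles"
  then obtain i w where "(t ^^ n) u = (t ^^ i) (\<iota> w)" by (auto simp: tiles_iff)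
  \<comment> \<open>Undo \<open>t ^^ n\<close> by applying \<open>t ^^ (p - n mod p)\<close> to both
    sides.\<close>
  then have "(t ^^ (p - n mod p + n mod p)) u = (t ^^ (p - n mod p + i)) (\<iota> w)"
    by (simp add: funpow_add funpow_mod del: le_add_diff_inverse2)
  moreover have "p - n mod p + n mod p = p" using p_pos by (simp add: less_imp_le)
  ultimately show "u \<in> tiles" by (auto simp: tiles_iff t_pow_p)
next
  assume "u \<in> tiles"
  then obtain i w where "u = (t ^^ i) (\<iota> w)" by (auto simp: tiles_iff)
  then show "(t ^^ n) u \<in> tiles" by (simp add: funpow_add_apply tile_mem)
qed

lemma conj_D_tile:
  assumes "m < p" "i < p"
  shows "conj_D m g ((t ^^ i) (\<iota> w)) = (t ^^ i) (\<iota> (if i = m then g w else w))"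
proof (cases "i = m")
  case True
  then show ?thesis
    using assms by (simp add: conj_D_def funpow_add_apply t_pow_p D_tile)
next
  case False
  have round: "(t ^^ m) ((t ^^ (p - m + i)) x) = (t ^^ i) x" for x
    using assms by (simp add: funpow_add_apply) (simp add: funpow_add t_pow_p)
  \<comment> \<open>Otherwise applying \<open>t ^^ m\<close> would place one point in both tile
    \<open>i\<close> and tile \<open>m\<close>.\<close>
  have "(t ^^ (p - m + i)) (\<iota> w) \<notin> range \<iota>"
  proof
    assume "(t ^^ (p - m + i)) (\<iota> w) \<in> range \<iota>"
    then obtain w' where "(t ^^ (p - m + i)) (\<iota> w) = \<iota> w'" by blast
    with round[of "\<iota> w"] have "(t ^^ i) (\<iota> w) = (t ^^ m) (\<iota> w')" by simp
    with tiles_inj assms False show False by blast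
  qed
  then show ?thesis
    using False round by (simp add: conj_D_def funpow_add_apply D_off)
qed

lemma conj_D_off:
  assumes "m < p" "u \<notin> tiles"
  shows "conj_D m g u = u"
proof -
  have "(t ^^ (p - m)) u \<notin> range \<iota>"
    using assms(2) funpow_tiles_iff[of "p - m" u] tile_mem(2) by auto
  then show ?thesis
    using assms by (simp add: conj_D_def D_off funpow_add_apply t_pow_p)
qed

lemma spread_tile:
  assumes "m \<le> p" "i < p"
  shows "spread f m ((t ^^ i) (\<iota> w)) = (t ^^ i) (\<iota> (if i < m then f (int i) w else w))"
  using assms by (induction m) (auto simp: conj_D_tile)

lemma spread_off: "m \<le> p \<Longrightarrow> u \<notin> tiles \<Longrightarrow> spread f m u = u"
  by (induction m) (simp_all add: conj_D_off)

section \<open>The wreath map is multiplicative and injective\<close>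

lemma wreath_map_tile:
  "i < p \<Longrightarrow> wreath_map (f, b) ((t ^^ i) (\<iota> w)) = (t ^^ (nat b + i)) (\<iota> (f (int i) w))"
  by (simp add: wreath_map_def spread_tile funpow_add)

lemma wreath_map_off: "u \<notin> tiles \<Longrightarrow> wreath_map (f, b) u = (t ^^ nat b) u"
  by (simp add: wreath_map_def spread_off)

text \<open>The first factor applies \<open>f i\<close> on tile \<open>i\<close> and carries it to
  tile \<open>(i + b) mod p\<close>, where the second applies its own component; hence the shift of
  \<open>f'\<close> by \<open>b\<close>. Off the tiles, which \<open>t\<close> preserves, only
  powers of \<open>t\<close> act. The restriction gives the extensional form used by
  \<open>product_group\<close>.\<close>

lemma wreath_map_mult:
  assumes b: "b \<in> {0..<int p}" "b' \<in> {0..<int p}"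
  shows "wreath_map (f', b') \<circ> wreath_map (f, b) =
    wreath_map (\<lambda>i\<in>{0..<int p}. f' ((i + b) mod int p) \<circ> f i, (b + b') mod int p)"
    (is "_ = ?R")
proof
  have nat_eq: "nat ((b + b') mod int p) = (nat b + nat b') mod p"
    using b by (simp add: nat_mod_distrib nat_add_distrib)
  fix u
  show "(wreath_map (f', b') \<circ> wreath_map (f, b)) u = ?R u"
  proof (cases "u \<in> tiles")
    case True
    then obtain i w where i: "i < p" and u: "u = (t ^^ i) (\<iota> w)" by (auto simp: tiles_def)
    let ?j = "(nat b + i) mod p"
    have j: "?j < p" "int ?j = (int i + b) mod int p"
      using p_pos b by (simp_all add: zmod_int add.commute)
    have "(wreath_map (f', b') \<circ> wreath_map (f, b)) u =
        wreath_map (f', b') ((t ^^ ?j) (\<iota> (f (int i) w)))"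
      using i by (simp add: u wreath_map_tile funpow_mod)
    also have "\<dots> = (t ^^ (nat b' + ?j)) (\<iota> (f' (int ?j) (f (int i) w)))"
      using j(1) by (rule wreath_map_tile)
    \<comment> \<open>Exponents matter only modulo \<open>p\<close>, so the reduction can be moved
      from \<open>nat b + i\<close> to \<open>nat b + nat b'\<close>.\<close>
    also have "t ^^ (nat b' + ?j) = t ^^ ((nat b' + ?j) mod p)"
      by (rule funpow_mod[symmetric])
    also have "(nat b' + ?j) mod p = ((nat b + nat b') mod p + i) mod p"
      by (simp add: mod_simps ac_simps)
    also have "t ^^ \<dots> = t ^^ ((nat b + nat b') mod p + i)"
      by (rule funpow_mod)
    finally show ?thesis
      using i j(2) by (simp add: u wreath_map_tile nat_eq)
  next
    case False
    have "(t ^^ nat b) u \<notin> tiles" using False by (simp add: funpow_tiles_iff)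
    then have "(wreath_map (f', b') \<circ> wreath_map (f, b)) u = (t ^^ (nat b' + nat b)) u"
      using False by (simp add: wreath_map_off funpow_add)
    also have "\<dots> = ?R u"
      using False by (simp add: wreath_map_off nat_eq funpow_mod add.commute)
    finally show ?thesis .
  qed
qed

text \<open>Tiles are disjoint, so the image of a point of tile \<open>i\<close> determines both its
  new tile, hence \<open>b\<close>, and its coordinate there, hence \<open>f i\<close>.\<close>

lemma wreath_map_inj:
  assumes eq: "wreath_map (f, b) = wreath_map (f', b')"
    and "b \<in> {0..<int p}" "b' \<in> {0..<int p}"
    and "f \<in> extensional {0..<int p}" "f' \<in> extensional {0..<int p}"
  shows "f = f' \<and> b = b'"
proof -
  have *: "(nat b + i) mod p = (nat b' + i) mod p \<and> f (int i) w = f' (int i) w" if "i < p" for i w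
  proof -
    have "(t ^^ ((nat b + i) mod p)) (\<iota> (f (int i) w)) = (t ^^ ((nat b' + i) mod p)) (\<iota> (f' (int i) w))"
      using fun_cong[OF eq, of "(t ^^ i) (\<iota> w)"] that by (simp add: wreath_map_tile funpow_mod)
    then show ?thesis using p_pos by (intro tiles_inj) simp_all
  qed
  have "nat b = nat b'" using *[of 0] p_pos assms(2,3) by auto
  then have "b = b'" using assms(2,3) by auto
  moreover have "f = f'"
  proof (rule extensionalityI[OF assms(4,5)])
    fix i assume "i \<in> {0..<int p}"
    then show "f i = f' i" using *[of "nat i"] by auto
  qed
  ultimately show ?thesis by simp
qed

text \<open>Closure under composition suffices, because the inverses used in conjugation are
  themselves powers of \<open>t\<close>.\<close>

lemma spread_mem:
  assumes "id \<in> K" "\<And>g h. g \<in> K \<Longrightarrow> h \<in> K \<Longrightarrow> h \<circ> g \<in> K"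
    and "t \<in> K" and "\<And>i. i \<in> {0..<int p} \<Longrightarrow> D (f i) \<in> K"
  shows "m \<le> p \<Longrightarrow> spread f m \<in> K" and "wreath_map (f, b) \<in> K"
proof -
  have pow: "t ^^ n \<in> K" for n
    using assms(1-3) by (induction n) (auto simp: id_def)
  show spread: "spread f m \<in> K" if "m \<le> p" for m
    using that
  proof (induction m)
    case (Suc m)
    then have "D (f (int m)) \<in> K" by (intro assms(4)) simp
    moreover have "spread f m \<in> K" using Suc by simp
    ultimately show ?case unfolding spread.simps conj_D_def by (intro assms(2) pow)
  qed (simp add: assms(1))
  show "wreath_map (f, b) \<in> K"
    by (simp add: wreath_map_def assms(2) pow spread)
qed

end

section \<open>Torsion and prefixes in the tree\<close>

lemma tree_aut_group_pow: "k [^]\<^bsub>tree_aut_group\<^esub> (n::nat) = k ^^ n"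
  by (induction n) (simp_all add: nat_pow_def tree_aut_group_def id_def)

text \<open>If \<open>l\<close> is the order of \<open>k\<close> and \<open>p\<close> a prime factor
  of it, then \<open>m = l / p\<close> is positive and less than \<open>l\<close>, so
  \<open>k ^^ m\<close> has order \<open>p\<close>.\<close>

lemma funpow_prime_period:
  fixes k :: "'a \<Rightarrow> 'a"
  assumes "k \<noteq> id" "n > 0" "k ^^ n = id"
  shows "\<exists>m p. Factorial_Ring.prime p \<and> k ^^ m \<noteq> id \<and> (k ^^ m) ^^ p = id"
proof -
  define l where "l = (LEAST n. n > 0 \<and> k ^^ n = id)"
  have l: "l > 0 \<and> k ^^ l = id" unfolding l_def by (rule LeastI[of _ n]) (use assms in simp)
  have least: "k ^^ m \<noteq> id" if "0 < m" "m < l" for m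
    using that not_less_Least[of m "\<lambda>n. n > 0 \<and> k ^^ n = id"] unfolding l_def by auto
  from l assms(1) have "l \<noteq> 1" by auto
  then obtain p where p: "Factorial_Ring.prime p" "p dvd l" using prime_factor_nat by blast
  then obtain m where m: "l = p * m" by (auto simp: dvd_def)
  then have "0 < m" "m < l" using l prime_gt_1_nat[OF p(1)] by auto
  then have "k ^^ m \<noteq> id" by (rule least)
  moreover have "(k ^^ m) ^^ p = id" using l m by (simp add: funpow_mult mult.commute)
  ultimately show ?thesis using p(1) by blast
qed

text \<open>A coincidence in the orbit makes \<open>t ^^ (j - i)\<close> fix \<open>v\<close>. As
  \<open>j - i\<close> is coprime to \<open>p\<close>, some power of this map is \<open>t\<close>
  itself, which would then fix \<open>v\<close>.\<close>

lemma funpow_prime_orbit: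
  fixes t :: "'a \<Rightarrow> 'a"
  assumes "Factorial_Ring.prime p" "t ^^ p = id" "t v \<noteq> v" "i < p" "j < p" "(t ^^ i) v = (t ^^ j) v"
  shows "i = j"
proof -
  have False if ij: "i < j" "j < p" "(t ^^ i) v = (t ^^ j) v" for i j
  proof -
    have "(t ^^ (j - i)) v = (t ^^ (p + (j - i))) v" by (simp add: funpow_add assms(2))
    also have "p + (j - i) = p - i + j" using ij by simp
    also have "(t ^^ (p - i + j)) v = (t ^^ (p - i + i)) v"
      by (simp only: funpow_add o_apply ij(3))
    also have "\<dots> = v" using ij assms(2) by simp
    finally have fix_d: "(t ^^ (j - i)) v = v" .
    have "\<not> p dvd j - i" using ij by (auto dest: dvd_imp_le)
    with assms(1) have "gcd (j - i) p = 1"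
      by (metis coprime_iff_gcd_eq_1 gcd.commute prime_imp_coprime)
    then obtain x y where "(j - i) * x = p * y + 1"
      using bezout_nat[of "j - i" p] ij by force
    moreover have "(t ^^ ((j - i) * x)) v = v"
      using fix_d by (induction x) (simp_all add: funpow_add)
    moreover have "t ^^ (p * y) = id"
      by (metis assms(2) funpow_mult id_funpow)
    ultimately have "t v = v" by (simp add: funpow_swap1)
    with assms(3) show False by simp
  qed
  from this[of i j] this[of j i] assms(4-6) show ?thesis by (metis linorder_neqE_nat)
qed

lemma tree_aut_append:
  assumes "is_tree_aut g" shows "\<exists>z. g (u @ w) = g u @ z \<and> length z = length w"
proof (induction w rule: rev_induct)
  case (snoc x w)
  with tree_aut_snoc[OF assms, of "u @ w" x] show ?case by auto
qed simp

lemma length_tree_aut: "is_tree_aut g \<Longrightarrow> length (g u) = length u"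
  using tree_aut_append[of g "[]" u] by (auto simp: is_tree_aut_def)

text \<open>Folding \<open>act_below\<close> over the letters of \<open>v\<close> transplants
  \<open>g\<close> to the subtree at \<open>v\<close>; this serves as \<open>D\<close>, with tile
  map \<open>(@) v\<close>.\<close>

lemma act_below_append: "foldr act_below v g (v @ w) = v @ g w"
  by (induction v) (simp_all add: act_below_def)

lemma act_below_off: "u \<notin> range ((@) v) \<Longrightarrow> foldr act_below v g u = u"
proof (induction v arbitrary: u)
  case (Cons x v)
  then show ?case by (cases u) (auto simp: act_below_def)
qed auto

lemma is_tree_aut_funpow: "is_tree_aut g \<Longrightarrow> is_tree_aut (g ^^ n)"
proof (induction n)
  case 0
  then show ?case using is_tree_aut_id by (simp add: id_def)
next
  case (Suc n)
  then show ?case unfolding funpow.simps by (intro is_tree_aut_comp)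
qed

lemma cyclic_tiles_tree:
  assumes t: "is_tree_aut t" and p: "Factorial_Ring.prime p" "t ^^ p = id" and v: "t v \<noteq> v"
  shows "cyclic_tiles t p ((@) v) (foldr act_below v)"
proof
  fix i j w w' assume ij: "i < p" "j < p" and eq: "(t ^^ i) (v @ w) = (t ^^ j) (v @ w')"
  note aut = is_tree_aut_funpow[OF t]
  \<comment> \<open>Translates of \<open>v\<close> have equal length, so if their subtrees share a
    vertex, they are the same prefix of it.\<close>
  obtain z z' where "(t ^^ i) v @ z = (t ^^ j) v @ z'"
    using tree_aut_append[OF aut] eq by metis
  then have "(t ^^ i) v = (t ^^ j) v" by (simp add: length_tree_aut[OF aut])
  with funpow_prime_orbit p v ij have "i = j" by metis
  moreover have "inj (t ^^ i)" using aut[of i] by (simp add: is_tree_aut_def bij_is_inj)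
  ultimately show "i = j \<and> w = w'" using eq by (auto dest: injD)
qed (use p prime_gt_0_nat act_below_append act_below_off in auto)

section \<open>Embedding the wreath product into \<open>K\<close>\<close>

theorem lemma59:
  fixes G K :: "('x::finite list \<Rightarrow> 'x list) set"
  assumes "weakly_branched G"
    and "branching_subgroup K G"
    and "\<exists>k\<in>K. k \<noteq> \<one>\<^bsub>tree_aut_group\<^esub> \<and>
           (\<exists>n::nat. n > 0 \<and> k [^]\<^bsub>tree_aut_group\<^esub> n = \<one>\<^bsub>tree_aut_group\<^esub>)"
  shows "\<exists>p::nat. p \<ge> 2 \<and>
           (\<exists>H. subgroup H (tree_aut_group\<lparr>carrier := K\<rparr>) \<and>
                tree_aut_group\<lparr>carrier := H\<rparr> \<cong>
                  regular_wreath (tree_aut_group\<lparr>carrier := K\<rparr>) (integer_mod_group p))"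
proof -
  let ?W = "tree_aut_group :: ('x list \<Rightarrow> 'x list) monoid"
  let ?K = "?W\<lparr>carrier := K\<rparr>"
  interpret W: group ?W by (rule group_tree_aut_group)
  have K: "subgroup K ?W"
    using assms(1,2) W.incl_subgroup
    unfolding weakly_branched_def self_similar_def branching_subgroup_def by blast
  then interpret K: group ?K by (rule W.subgroup_imp_group)
  have idK: "id \<in> K" using subgroup.one_closed[OF K] by (simp add: tree_aut_group_def)
  have compK: "h \<circ> g \<in> K" if "g \<in> K" "h \<in> K" for g h
    using subgroup.m_closed[OF K that] by (simp add: tree_aut_group_def)
  \<comment> \<open>Each letter of \<open>v\<close> costs one use of the branching
    condition.\<close>
  have belowK: "foldr act_below v g \<in> K" if "g \<in> K" for v g
    using that assms(2) base_subset_iff[OF K]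
    by (induction v) (auto simp: branching_subgroup_def)
  obtain k and n :: nat where k: "k \<in> K" "k \<noteq> id" "n > 0" "k ^^ n = id"
    using assms(3) by (auto simp: tree_aut_group_pow) (auto simp: tree_aut_group_def)
  obtain m p where mp: "Factorial_Ring.prime p" "k ^^ m \<noteq> id" "(k ^^ m) ^^ p = id"
    using funpow_prime_period[OF k(2-4)] by blast
  define t where "t = k ^^ m"
  have tK: "t \<in> K" unfolding t_def
    using idK compK k(1) by (induction m) (auto simp: id_def)
  have "is_tree_aut t" using subgroup.subset[OF K] tK by (auto simp: tree_aut_group_def)
  moreover obtain v where "t v \<noteq> v" using mp(2) by (auto simp: t_def fun_eq_iff)
  ultimately interpret cyclic_tiles t p "(@) v" "foldr act_below v"
    using mp by (intro cyclic_tiles_tree) (simp_all add: t_def)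
  let ?R = "regular_wreath ?K (integer_mod_group p)"
  have grp: "group ?R" using K.group_axioms by (intro group_regular_wreath) simp_all
  \<comment> \<open>Positivity of \<open>p\<close> matters here: \<open>integer_mod_group 0\<close>
    is the infinite cyclic group.\<close>
  have carrR: "carrier ?R = ({0..<int p} \<rightarrow>\<^sub>E K) \<times> {0..<int p}"
    using p_pos by (simp add: regular_wreath_def semidirect_product_def carrier_integer_mod_group)
  have "wreath_map \<in> hom ?R ?K"
  proof (rule homI)
    fix y assume "y \<in> carrier ?R"
    then show "wreath_map y \<in> carrier ?K"
      using idK compK tK belowK by (cases y) (auto simp: carrR PiE_iff intro!: spread_mem(2))
  next
    fix y z assume "y \<in> carrier ?R" "z \<in> carrier ?R"
    then show "wreath_map (y \<otimes>\<^bsub>?R\<^esub> z) = wreath_map y \<otimes>\<^bsub>?K\<^esub> wreath_map z"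
      using p_pos
      by (cases y; cases z)
        (auto simp: carrR wreath_map_mult tree_aut_group_def regular_wreath_def
          semidirect_product_def carrier_integer_mod_group mult_integer_mod_group
          intro!: arg_cong[of _ _ wreath_map] restrict_ext)
  qed
  then interpret hom: group_hom ?R ?K wreath_map
    using grp K.group_axioms by (simp add: group_hom_def group_hom_axioms_def)
  have inj: "inj_on wreath_map (carrier ?R)"
  proof (rule inj_onI)
    fix y z assume "y \<in> carrier ?R" "z \<in> carrier ?R" "wreath_map y = wreath_map z"
    then show "y = z"
      using wreath_map_inj by (cases y; cases z) (auto simp: carrR PiE_def)
  qed
  let ?H = "wreath_map ` carrier ?R"
  have H: "subgroup ?H ?K" by (rule hom.img_is_subgroup)
  have "wreath_map \<in> iso ?R (?W\<lparr>carrier := ?H\<rparr>)"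
    using hom.homh inj by (auto simp: iso_def hom_def bij_betw_def)
  then have "?R \<cong> ?W\<lparr>carrier := ?H\<rparr>" by (auto simp: is_iso_def)
  then have "?W\<lparr>carrier := ?H\<rparr> \<cong> ?R" by (rule group.iso_sym[OF grp])
  with H prime_ge_2_nat[OF mp(1)] show ?thesis by blast
qed

end
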